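(* Consider the PDBO iterates $(x^t,y^t)_{t\ge 0}$ (defined in the context) generated from $F:\{0,1\}^n\to\mathbb{R}$ with multilinear extension $f$, a binarity constraint function $g$, an initial point $(x^0,y^0)\in[0,1]^n\times\mathbb{R}_{>0}^n$, step sizes $\alpha,\beta>0$ and tolerance $\delta\in(0,\tfrac12)$. Then for every $i\in\{1,\dots,n\}$, the sequence $(g(x_i^t))_{t\ge0}$ converges to $0$.
   Context: Multilinear extension: for $F:\{0,1\}^n\to\mathbb{R}$, $f(x)=\sum_{\xi\in\{0,1\}^n} P_x(\xi)F(\xi)$, where $P_x(\xi)=\prod_{i=1}^n x_i^{\xi_i}(1-x_i)^{1-\xi_i}$ (with $0^0=1$). It is a polynomial, so its gradient is defined everywhere on $[0,1]^n$. Binarity constraint function: $g:[0,1]\to\mathbb{R}$ such that (i) $g$ is convex and continuous on $[0,1]$ with $g(0)=g(1)=0$; (ii) $g$ is differentiable on $(0,1)$, and $g'(x)=0$ if and only if $x=\tfrac12$; (iii) $g(x)=g(1-x)$ for all $x\in[0,1]$. At the endpoints, $g'(0)$ and $g'(1)$ denote the one-sided derivatives in $[-\infty,+\infty]$, with the convention $0\cdot(\pm\infty)=0$. Lagrangian: $L(x,y)=f(x)+\sum_{i=1}^n y_i g(x_i)$, so $\frac{\partial}{\partial x_i}L(x,y)=\frac{\partial f}{\partial x_i}(x)+y_i g'(x_i)$. PDBO iterates: given $(x^0,y^0)\in[0,1]^n\times\mathbb{R}^n_{>0}$, step sizes $\alpha,\beta>0$ and tolerance $\delta$, for $t=0,1,2,\dots$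 and each $i\in\{1,\dots,n\}$ set: - if $|x_i^t-\frac12|\le\delta$ and $\left|\frac{\partial}{\partial x_i}L(x^t,y^t)\right|\le 2\delta$ and $y_i^t\le 0$, then $x_i^{t+1}=\frac12-\delta$ if $x_i^t\le\frac12$, and $x_i^{t+1}=\frac12+\delta$ otherwise; - else $x_i^{t+1}=\Pi_{[0,1]}\left(x_i^t-\alpha\frac{\partial}{\partial x_i}L(x^t,y^t)\right)$, where $\Pi_{[0,1]}$ is projection onto $[0,1]$ (sending $-\infty$ to $0$ and $+\infty$ to $1$); - in both cases $y_i^{t+1}=y_i^t+\beta\, g(x_i^t)$. The iteration is run indefinitely (no cap on the number of iterations). *)

theory Defs
  imports "HOL-Analysis.Analysis"
begin

text \<open>
  The cube \<open>{0,1}\<^sup>n\<close> is the type \<^typ>\<open>bool ^ 'n\<close>, with \<^const>\<open>of_bool\<close> reading a bit as \<open>0\<close> or \<open>1\<close>.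
\<close>

definition bit_weight :: "real ^ 'n \<Rightarrow> bool ^ 'n::finite \<Rightarrow> real" where
  "bit_weight x \<xi> = (\<Prod>i\<in>UNIV. (x $ i) ^ of_bool (\<xi> $ i) * (1 - x $ i) ^ (1 - of_bool (\<xi> $ i)))"

definition multilinear_ext :: "(bool ^ 'n::finite \<Rightarrow> real) \<Rightarrow> real ^ 'n \<Rightarrow> real" where
  "multilinear_ext F x = (\<Sum>\<xi>\<in>UNIV. bit_weight x \<xi> * F \<xi>)"

definition partial_deriv :: "(real ^ 'n::finite \<Rightarrow> real) \<Rightarrow> 'n \<Rightarrow> real ^ 'n \<Rightarrow> real" where
  "partial_deriv f i x = deriv (\<lambda>s. f (x + s *\<^sub>R axis i 1)) 0"

text \<open>
  Functions on \<open>[0,1]\<close> are total functions on the reals of which only the values on \<open>[0,1]\<close> are used.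
\<close>

definition binarity_constraint :: "(real \<Rightarrow> real) \<Rightarrow> bool" where
  "binarity_constraint g \<longleftrightarrow>
     convex_on {0..1} g \<and> continuous_on {0..1} g \<and> g 0 = 0 \<and> g 1 = 0 \<and>
     (\<forall>x\<in>{0<..<1}. g field_differentiable (at x) \<and> (deriv g x = 0 \<longleftrightarrow> x = 1/2)) \<and>
     (\<forall>x\<in>{0..1}. g x = g (1 - x))"

text \<open>
  The derivative of \<open>g\<close> on \<open>[0,1]\<close>; at the endpoints the one-sided difference quotients are taken to
  their limit in the extended reals, where it exists by convexity and may be infinite.
\<close>

definition deriv01 :: "(real \<Rightarrow> real) \<Rightarrow> real \<Rightarrow> ereal" where
  "deriv01 g x =
     (if x = 0 then Lim (at_right 0) (\<lambda>s. ereal ((g s - g 0) / (s - 0)))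
      else if x = 1 then Lim (at_left 1) (\<lambda>s. ereal ((g s - g 1) / (s - 1)))
      else ereal (deriv g x))"

definition lagrangian ::
  "(bool ^ 'n::finite \<Rightarrow> real) \<Rightarrow> (real \<Rightarrow> real) \<Rightarrow> real ^ 'n \<Rightarrow> real ^ 'n \<Rightarrow> real" where
  "lagrangian F g x y = multilinear_ext F x + (\<Sum>i\<in>UNIV. y $ i * g (x $ i))"

text \<open>
  The partial derivative of the Lagrangian in \<open>x\<^sub>i\<close>, extended to the faces \<open>x\<^sub>i \<in> {0,1}\<close>; the convention
  \<open>0 \<cdot> (\<plusminus>\<infinity>) = 0\<close> is that of \<^typ>\<open>ereal\<close>. Away from these faces it is the actual partial
  derivative, see \<open>lagrangian_deriv_interior\<close> below.
\<close>

definition lagrangian_deriv ::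
  "(bool ^ 'n::finite \<Rightarrow> real) \<Rightarrow> (real \<Rightarrow> real) \<Rightarrow> 'n \<Rightarrow> real ^ 'n \<Rightarrow> real ^ 'n \<Rightarrow> ereal" where
  "lagrangian_deriv F g i x y =
     ereal (partial_deriv (multilinear_ext F) i x) + ereal (y $ i) * deriv01 g (x $ i)"

definition proj01 :: "ereal \<Rightarrow> real" where
  "proj01 z = (if z = \<infinity> then 1 else if z = -\<infinity> then 0 else closest_point {0..1} (real_of_ereal z))"

definition pdbo_step ::
  "(bool ^ 'n::finite \<Rightarrow> real) \<Rightarrow> (real \<Rightarrow> real) \<Rightarrow> real \<Rightarrow> real \<Rightarrow> real \<Rightarrow>
   (real ^ 'n) \<times> (real ^ 'n) \<Rightarrow> (real ^ 'n) \<times> (real ^ 'n)" where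
  "pdbo_step F g \<alpha> \<beta> \<delta> = (\<lambda>(x, y).
     (\<chi> i. if \<bar>x $ i - 1/2\<bar> \<le> \<delta> \<and> \<bar>lagrangian_deriv F g i x y\<bar> \<le> ereal (2 * \<delta>) \<and> y $ i \<le> 0
           then (if x $ i \<le> 1/2 then 1/2 - \<delta> else 1/2 + \<delta>)
           else proj01 (ereal (x $ i) - ereal \<alpha> * lagrangian_deriv F g i x y),
      \<chi> i. y $ i + \<beta> * g (x $ i)))"

primrec pdbo ::
  "(bool ^ 'n::finite \<Rightarrow> real) \<Rightarrow> (real \<Rightarrow> real) \<Rightarrow> real \<Rightarrow> real \<Rightarrow> real \<Rightarrow>
   real ^ 'n \<Rightarrow> real ^ 'n \<Rightarrow> nat \<Rightarrow> (real ^ 'n) \<times> (real ^ 'n)" where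
  "pdbo F g \<alpha> \<beta> \<delta> x0 y0 0 = (x0, y0)"
| "pdbo F g \<alpha> \<beta> \<delta> x0 y0 (Suc t) = pdbo_step F g \<alpha> \<beta> \<delta> (pdbo F g \<alpha> \<beta> \<delta> x0 y0 t)"

lemma multilinear_ext_has_partial_deriv:
  "((\<lambda>s. multilinear_ext F (x + s *\<^sub>R axis i 1)) has_field_derivative
      partial_deriv (multilinear_ext F) i x) (at 0)"
proof -
  have lin: "\<exists>d. ((\<lambda>s. (x + s *\<^sub>R axis i 1) $ j) has_field_derivative d) (at 0)" for j
    by (cases "j = i") (auto simp: axis_def intro!: exI derivative_eq_intros)
  have bit: "(\<lambda>s. ((x + s *\<^sub>R axis i 1) $ j) ^ of_bool b *
      (1 - (x + s *\<^sub>R axis i 1) $ j) ^ (1 - of_bool b)) differentiable (at 0)" for j b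
  proof -
    obtain d where d: "((\<lambda>s. (x + s *\<^sub>R axis i 1) $ j) has_field_derivative d) (at 0)"
      using lin by blast
    show ?thesis
      unfolding real_differentiable_def
      using d DERIV_diff[OF DERIV_const d, of 1]
      by (cases b) (auto simp del: vector_add_component vector_scaleR_component)
  qed
  have weight: "(\<lambda>s. bit_weight (x + s *\<^sub>R axis i 1) \<xi>) differentiable (at 0)" for \<xi>
  proof -
    let ?f = "\<lambda>j s. ((x + s *\<^sub>R axis i 1) $ j) ^ of_bool (\<xi> $ j) *
        (1 - (x + s *\<^sub>R axis i 1) $ j) ^ (1 - of_bool (\<xi> $ j))"
    have D: "(?f j has_field_derivative deriv (?f j) 0) (at 0)" for j
      using bit[of j "\<xi> $ j"] unfolding real_differentiable_def
      by (metis (no_types, lifting) DERIV_imp_deriv)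
    have "((\<lambda>s. \<Prod>j\<in>UNIV. ?f j s) has_field_derivative
        (\<Sum>j\<in>UNIV. deriv (?f j) 0 * (\<Prod>k\<in>UNIV - {j}. ?f k 0))) (at 0)"
      by (rule has_field_derivative_prod) (rule D)
    then show ?thesis
      unfolding bit_weight_def real_differentiable_def by (rule exI)
  qed
  have "(\<lambda>s. multilinear_ext F (x + s *\<^sub>R axis i 1)) differentiable (at 0)"
    unfolding multilinear_ext_def
    by (intro differentiable_sum differentiable_mult differentiable_const weight ballI) simp
  then show ?thesis
    unfolding partial_deriv_def real_differentiable_def by (auto dest: DERIV_imp_deriv)
qed

lemma lagrangian_deriv_interior:
  assumes "binarity_constraint g" "0 < x $ i" "x $ i < 1"
  shows "lagrangian_deriv F g i x y = ereal (partial_deriv (\<lambda>x. lagrangian F g x y) i x)"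
    and "((\<lambda>s. lagrangian F g (x + s *\<^sub>R axis i 1) y) has_field_derivative
           partial_deriv (\<lambda>x. lagrangian F g x y) i x) (at 0)"
proof -
  have g: "(g has_field_derivative deriv g (x $ i)) (at (x $ i))"
  proof -
    have "\<forall>x\<in>{0<..<1}. g field_differentiable (at x)"
      using assms(1) unfolding binarity_constraint_def by blast
    moreover have "x $ i \<in> {0<..<1}"
      using assms(2,3) by simp
    ultimately show ?thesis
      by (intro field_differentiable_derivI) (rule bspec)
  qed
  have "((\<lambda>s. y $ j * g ((x + s *\<^sub>R axis i 1) $ j)) has_field_derivative
           (if j = i then y $ i * deriv g (x $ i) else 0)) (at 0)" for j
  proof (cases "j = i")
    case True
    have "((\<lambda>s. g (x $ i + s)) has_field_derivative deriv g (x $ i)) (at 0)"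
      using g DERIV_shift[of g "deriv g (x $ i)" 0 "x $ i"] by (simp add: add.commute)
    then show ?thesis using True by (simp add: axis_def DERIV_cmult)
  qed (simp add: axis_def)
  then have "((\<lambda>s. \<Sum>j\<in>UNIV. y $ j * g ((x + s *\<^sub>R axis i 1) $ j)) has_field_derivative
           (\<Sum>j\<in>UNIV. if j = i then y $ i * deriv g (x $ i) else 0)) (at 0)"
    by (intro DERIV_sum)
  then have L: "((\<lambda>s. lagrangian F g (x + s *\<^sub>R axis i 1) y) has_field_derivative
      partial_deriv (multilinear_ext F) i x + y $ i * deriv g (x $ i)) (at 0)"
    unfolding lagrangian_def
    by (intro DERIV_add multilinear_ext_has_partial_deriv) simp
  have eq: "partial_deriv (\<lambda>x. lagrangian F g x y) i x =
      partial_deriv (multilinear_ext F) i x + y $ i * deriv g (x $ i)"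
    by (subst partial_deriv_def) (rule DERIV_imp_deriv[OF L])
  show "lagrangian_deriv F g i x y = ereal (partial_deriv (\<lambda>x. lagrangian F g x y) i x)"
    using assms(2,3) by (simp add: eq lagrangian_deriv_def deriv01_def)
  show "((\<lambda>s. lagrangian F g (x + s *\<^sub>R axis i 1) y) has_field_derivative
           partial_deriv (\<lambda>x. lagrangian F g x y) i x) (at 0)"
    unfolding eq by (rule L)
qed

end

theory Submission
  imports Defs
begin

text \<open>
  Since \<open>g \<le> 0\<close>, each multiplier \<open>y\<^sub>i\<close> is nonincreasing. If it stays bounded below it converges, and
  its increments \<open>\<beta> g(x\<^sub>i)\<close> vanish in the limit. Otherwise \<open>y\<^sub>i \<rightarrow> -\<infinity>\<close> while \<open>\<partial>f/\<partial>x\<^sub>i\<close> stays bounded, so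
  once \<open>y\<^sub>i\<close> is very negative every step from a point with \<open>\<bar>x\<^sub>i - 1/2\<bar> \<ge> \<eta>\<close> lands on the nearer of
  \<open>0\<close> and \<open>1\<close> and remains there, where \<open>g\<close> vanishes. An iterate cannot stay within
  \<open>\<eta> = min \<delta> (\<alpha>\<delta>)\<close> of \<open>1/2\<close> during two consecutive steps: a gradient step that short has
  \<open>\<bar>\<partial>L/\<partial>x\<^sub>i\<bar> \<le> 2\<delta>\<close>, and in that case the rule that jumps to distance \<open>\<delta>\<close> from \<open>1/2\<close> applies instead.
\<close>

section \<open>Projection onto the unit interval\<close>

lemma closest_point_Icc_real:
  fixes a b r :: real
  assumes "a \<le> b"
  shows "closest_point {a..b} r = max a (min b r)"
  by (rule closest_point_unique[symmetric])
    (use assms in \<open>auto simp: dist_real_def max_def min_def\<close>)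

lemma proj01_simps:
  "proj01 (ereal r) = max 0 (min 1 r)" "proj01 \<infinity> = 1" "proj01 (-\<infinity>) = 0"
  by (simp_all add: proj01_def closest_point_Icc_real)

lemma proj01_mem: "proj01 z \<in> {0..1}"
  by (cases z) (auto simp: proj01_simps)

lemma proj01_eq_1: "1 \<le> z \<Longrightarrow> proj01 z = 1"
  by (cases z) (auto simp: proj01_simps one_ereal_def)

lemma proj01_eq_0: "z \<le> 0 \<Longrightarrow> proj01 z = 0"
  by (cases z) (auto simp: proj01_simps zero_ereal_def)

text \<open>Clipping only produces 0 or 1, so an interior value is the unprojected point itself.
  This recovers the exact gradient step from two consecutive iterates.\<close>

lemma proj01_interior:
  assumes "0 < proj01 z" "proj01 z < 1"
  shows "z = ereal (proj01 z)"
  using assms by (cases z) (auto simp: proj01_simps max_def min_def split: if_splits)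

section \<open>A uniform bound on the gradient of the multilinear extension\<close>

text \<open>As a function of the \<open>i\<close>-th coordinate the weight is affine: that
  coordinate or its complement to 1, times a product of factors in [0,1]. The derivative is plus or
  minus that product.\<close>

lemma abs_bit_weight_partial_deriv_le_1:
  assumes "\<And>j. x $ j \<in> {0..1}"
  shows "\<exists>d. ((\<lambda>s. bit_weight (x + s *\<^sub>R axis i 1) \<xi>) has_field_derivative d) (at 0) \<and> \<bar>d\<bar> \<le> 1"
proof -
  define w where "w j t = (t::real) ^ of_bool (\<xi> $ j) * (1 - t) ^ (1 - of_bool (\<xi> $ j))" for j t
  define R where "R = (\<Prod>j\<in>UNIV - {i}. w j (x $ j))"
  have w01: "w j t \<in> {0..1}" if "t \<in> {0..1}" for j t
    using that by (cases "\<xi> $ j") (auto simp: w_def)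
  have "0 \<le> R" "R \<le> 1"
    unfolding R_def using w01[OF assms] by (auto intro!: prod_nonneg prod_le_1)
  have split: "bit_weight (x + s *\<^sub>R axis i 1) \<xi> = w i (x $ i + s) * R" for s
  proof -
    have "bit_weight (x + s *\<^sub>R axis i 1) \<xi> = (\<Prod>j\<in>UNIV. w j (x $ j + s * axis i 1 $ j))"
      by (simp add: bit_weight_def w_def)
    also have "\<dots> = w i (x $ i + s * axis i 1 $ i) * (\<Prod>j\<in>UNIV - {i}. w j (x $ j + s * axis i 1 $ j))"
      by (rule prod.remove) auto
    also have "(\<Prod>j\<in>UNIV - {i}. w j (x $ j + s * axis i 1 $ j)) = R"
      unfolding R_def by (rule prod.cong) (auto simp: axis_def)
    finally show ?thesis by (simp add: axis_def)
  qed
  have "((\<lambda>s. w i (x $ i + s) * R) has_field_derivative (if \<xi> $ i then R else - R)) (at 0)"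
    by (cases "\<xi> $ i") (auto simp: w_def intro!: derivative_eq_intros)
  then show ?thesis
    unfolding split using \<open>0 \<le> R\<close> \<open>R \<le> 1\<close> by (intro exI conjI) auto
qed

text \<open>The bound is the same at every point of the cube, so a single threshold for the
  multiplier will serve all iterates.\<close>

lemma abs_partial_deriv_multilinear_ext_le:
  assumes "\<And>j. x $ j \<in> {0..1}"
  shows "\<bar>partial_deriv (multilinear_ext F) i x\<bar> \<le> (\<Sum>\<xi>\<in>UNIV. \<bar>F \<xi>\<bar>)"
proof -
  obtain d where d: "\<And>\<xi>. ((\<lambda>s. bit_weight (x + s *\<^sub>R axis i 1) \<xi>) has_field_derivative d \<xi>) (at 0)"
    and d1: "\<And>\<xi>. \<bar>d \<xi>\<bar> \<le> 1"
    using abs_bit_weight_partial_deriv_le_1[OF assms] by metis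
  have "((\<lambda>s. multilinear_ext F (x + s *\<^sub>R axis i 1)) has_field_derivative (\<Sum>\<xi>\<in>UNIV. d \<xi> * F \<xi>)) (at 0)"
    unfolding multilinear_ext_def by (intro DERIV_sum DERIV_cmult_right d)
  then have "partial_deriv (multilinear_ext F) i x = (\<Sum>\<xi>\<in>UNIV. d \<xi> * F \<xi>)"
    unfolding partial_deriv_def by (rule DERIV_imp_deriv)
  also have "\<bar>\<dots>\<bar> \<le> (\<Sum>\<xi>\<in>UNIV. \<bar>d \<xi> * F \<xi>\<bar>)"
    by (rule sum_abs)
  also have "\<dots> \<le> (\<Sum>\<xi>\<in>UNIV. \<bar>F \<xi>\<bar>)"
    using d1 by (intro sum_mono) (simp add: abs_mult mult_left_le_one_le)
  finally show ?thesis .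
qed

section \<open>Convexity of the constraint function\<close>

lemma binarity_constraintD:
  assumes "binarity_constraint g"
  shows "convex_on {0..1} g" "g 0 = 0" "g 1 = 0"
    and "x \<in> {0<..<1} \<Longrightarrow> g field_differentiable (at x)"
    and "x \<in> {0<..<1} \<Longrightarrow> deriv g x = 0 \<longleftrightarrow> x = 1/2"
  using assms unfolding binarity_constraint_def by blast+

text \<open>A convex function lies below its chord, and the chord from 0 to 1 is zero.\<close>

lemma binarity_constraint_nonpos:
  assumes "binarity_constraint g" "x \<in> {0..1}"
  shows "g x \<le> 0"
  using convex_onD[of "{0..1}" g x 0 1] binarity_constraintD(1-3)[OF assms(1)] assms(2) by simp

lemma binarity_constraint_above_tangent:
  assumes "binarity_constraint g" "c \<in> {0<..<1}" "x \<in> {0..1}"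
  shows "deriv g c * (x - c) \<le> g x - g c"
proof (rule convex_on_imp_above_tangent[of "{0..1}"])
  show "(g has_field_derivative deriv g c) (at c within {0..1})"
    by (intro has_field_derivative_at_within[OF field_differentiable_derivI]
        binarity_constraintD(4)[OF assms(1,2)])
qed (use assms(2,3) binarity_constraintD(1)[OF assms(1)] in auto)

lemma binarity_constraint_deriv_mono:
  assumes "binarity_constraint g" "a \<in> {0<..<1}" "b \<in> {0<..<1}" "a \<le> b"
  shows "deriv g a \<le> deriv g b"
proof (cases "a = b")
  case False
  \<comment> \<open>Adding the tangent inequalities at the two points eliminates the values of
    \<open>g\<close>.\<close>
  have "deriv g a * (b - a) \<le> g b - g a" "deriv g b * (a - b) \<le> g a - g b"
    using assms by (auto intro: binarity_constraint_above_tangent)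
  then have "deriv g a * (b - a) \<le> deriv g b * (b - a)"
    by (simp add: algebra_simps)
  then show ?thesis using False assms(4) by simp
qed simp

lemma binarity_constraint_slope_mono:
  assumes "binarity_constraint g" "0 < s" "s \<le> t" "t < 1"
  shows "(g s - g 0) / (s - 0) \<le> (g t - g 0) / (t - 0)"
    and "(g s - g 1) / (s - 1) \<le> (g t - g 1) / (t - 1)"
proof -
  note conv = binarity_constraintD(1)[OF assms(1)] and g0 = binarity_constraintD(2)[OF assms(1)]
  show "(g s - g 0) / (s - 0) \<le> (g t - g 0) / (t - 0)"
  proof (cases "s = t")
    case False
    then show ?thesis
      using convex_on_slope_le(1)[OF conv, of 0 t s] assms by (simp add: g0)
  qed simp
  show "(g s - g 1) / (s - 1) \<le> (g t - g 1) / (t - 1)"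
    using convex_on_slope_le(2)[OF conv, of s 1 t] assms by (cases "s = t") auto
qed

section \<open>Endpoint derivatives and their sign\<close>

text \<open>\<open>Lim\<close> only denotes the limit once convergence is known. Chord slopes from
  an endpoint are monotone, so they converge in the extended reals to their infimum at 0 and their
  supremum at 1.\<close>

lemma deriv01_endpoint_tendsto:
  assumes "binarity_constraint g"
  shows "((\<lambda>s. ereal ((g s - g 0) / (s - 0))) \<longlongrightarrow> deriv01 g 0) (at_right 0)"
    and "((\<lambda>s. ereal ((g s - g 1) / (s - 1))) \<longlongrightarrow> deriv01 g 1) (at_left 1)"
proof -
  let ?f0 = "\<lambda>s. ereal ((g s - g 0) / (s - 0))"
  let ?f1 = "\<lambda>s. ereal ((g s - g 1) / (s - 1))"
  \<comment> \<open>Monotonicity is available only below 1; restricting to that range does not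
    change the one-sided filter.\<close>
  have "at 0 within ({0<..} \<inter> {..<1}) = at_right (0::real)"
    by (rule at_within_nhd[of _ "{..<1}"]) auto
  moreover have "(?f0 \<longlongrightarrow> Inf (?f0 ` ({0<..} \<inter> {..<1}))) (at 0 within ({0<..} \<inter> {..<1}))"
    by (rule Lim_right_bound[of _ _ _ "-\<infinity>"])
      (use binarity_constraint_slope_mono(1)[OF assms] in auto)
  ultimately show "(?f0 \<longlongrightarrow> deriv01 g 0) (at_right 0)"
    by (simp add: deriv01_def tendsto_Lim)
  have "at 1 within ({..<1} \<inter> {0<..}) = at_left (1::real)"
    by (rule at_within_nhd[of _ "{0<..}"]) auto
  moreover have "(?f1 \<longlongrightarrow> Sup (?f1 ` ({..<1} \<inter> {0<..}))) (at 1 within ({..<1} \<inter> {0<..}))"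
    by (rule Lim_left_bound[of _ _ _ "\<infinity>"])
      (use binarity_constraint_slope_mono(2)[OF assms] in auto)
  ultimately show "(?f1 \<longlongrightarrow> deriv01 g 1) (at_left 1)"
    by (simp add: deriv01_def tendsto_Lim)
qed

text \<open>In the interior this is monotonicity of the derivative. At 1, the tangent at
  \<open>s\<close> shows that the chord slope from \<open>s\<close> to 1 is at least the derivative
  at \<open>s\<close>, hence at least that at \<open>a\<close>, and the bound survives the
  limit.\<close>

lemma deriv01_ge:
  assumes g: "binarity_constraint g" and a: "0 < a" "a < 1" and x: "a \<le> x" "x \<le> 1"
  shows "ereal (deriv g a) \<le> deriv01 g x"
proof (cases "x = 1")
  case True
  have "eventually (\<lambda>s. s \<in> {a<..<1}) (at_left 1)"
    by (rule eventually_at_leftI[of a 1]) (use a in auto)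
  then have "eventually (\<lambda>s. ereal (deriv g a) \<le> ereal ((g s - g 1) / (s - 1))) (at_left 1)"
  proof eventually_elim
    case (elim s)
    have "deriv g a * (1 - s) \<le> deriv g s * (1 - s)"
      using elim a by (intro mult_right_mono binarity_constraint_deriv_mono[OF g]) auto
    also have "\<dots> \<le> g 1 - g s"
      using elim a by (intro binarity_constraint_above_tangent[OF g]) auto
    finally show ?case
      using elim by (simp add: divide_simps) (simp add: algebra_simps)
  qed
  then show ?thesis
    unfolding True by (rule tendsto_lowerbound[OF deriv01_endpoint_tendsto(2)[OF g]]) simp
next
  case False
  then show ?thesis
    using assms binarity_constraint_deriv_mono[OF g, of a x] by (simp add: deriv01_def)
qed

lemma deriv01_le:
  assumes g: "binarity_constraint g" and b: "0 < b" "b < 1" and x: "0 \<le> x" "x \<le> b"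
  shows "deriv01 g x \<le> ereal (deriv g b)"
proof (cases "x = 0")
  case True
  have "eventually (\<lambda>s. s \<in> {0<..<b}) (at_right 0)"
    by (rule eventually_at_rightI[of 0 b]) (use b in auto)
  then have "eventually (\<lambda>s. ereal ((g s - g 0) / (s - 0)) \<le> ereal (deriv g b)) (at_right 0)"
  proof eventually_elim
    case (elim s)
    have "deriv g s * (0 - s) \<le> g 0 - g s"
      using elim b by (intro binarity_constraint_above_tangent[OF g]) auto
    then have "g s - g 0 \<le> deriv g s * s"
      by simp
    also have "\<dots> \<le> deriv g b * s"
      using elim b by (intro mult_right_mono binarity_constraint_deriv_mono[OF g]) auto
    finally show ?case
      using elim by (simp add: divide_simps)
  qed
  then show ?thesis
    unfolding True by (rule tendsto_upperbound[OF deriv01_endpoint_tendsto(1)[OF g]]) simp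
next
  case False
  then show ?thesis
    using assms binarity_constraint_deriv_mono[OF g, of x b] by (simp add: deriv01_def)
qed

lemma deriv01_away_from_half:
  assumes g: "binarity_constraint g" and \<eta>: "0 < \<eta>" "\<eta> < 1/2"
  obtains c where "0 < c"
    and "\<And>x. 1/2 + \<eta> \<le> x \<Longrightarrow> x \<le> 1 \<Longrightarrow> ereal c \<le> deriv01 g x"
    and "\<And>x. 0 \<le> x \<Longrightarrow> x \<le> 1/2 - \<eta> \<Longrightarrow> deriv01 g x \<le> ereal (- c)"
proof -
  \<comment> \<open>Since the derivative is monotone and vanishes only at 1/2, outside the
    \<eta>-neighbourhood it is smallest in absolute value at the two boundary points, where it is
    nonzero.\<close>
  define c where "c = min (deriv g (1/2 + \<eta>)) (- deriv g (1/2 - \<eta>))"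
  note zero = binarity_constraintD(5)[OF g]
  have "deriv g (1/2) \<le> deriv g (1/2 + \<eta>)" "deriv g (1/2 - \<eta>) \<le> deriv g (1/2)"
    using \<eta> by (auto intro!: binarity_constraint_deriv_mono[OF g])
  then have "0 < c"
    using zero[of "1/2"] zero[of "1/2 + \<eta>"] zero[of "1/2 - \<eta>"] \<eta> by (auto simp: c_def)
  moreover have "ereal c \<le> deriv01 g x" if "1/2 + \<eta> \<le> x" "x \<le> 1" for x
  proof -
    have "ereal c \<le> ereal (deriv g (1/2 + \<eta>))" by (simp add: c_def)
    also have "\<dots> \<le> deriv01 g x" using \<eta> that by (intro deriv01_ge[OF g]) auto
    finally show ?thesis .
  qed
  moreover have "deriv01 g x \<le> ereal (- c)" if "0 \<le> x" "x \<le> 1/2 - \<eta>" for x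
  proof -
    have "deriv01 g x \<le> ereal (deriv g (1/2 - \<eta>))" using \<eta> that by (intro deriv01_le[OF g]) auto
    also have "\<dots> \<le> ereal (- c)" by (simp add: c_def)
    finally show ?thesis .
  qed
  ultimately show thesis by (rule that)
qed

section \<open>Gradient steps with a very negative multiplier\<close>

text \<open>The term \<open>y * D\<close> is at most \<open>y * c\<close>, which outweighs
  \<open>P\<close> by at least \<open>K\<close>; a step of length at least
  \<open>\<alpha> * K\<close>, hence at least 1, then crosses the whole interval. An infinite
  \<open>D\<close> makes the gradient minus infinity, which the projection sends to 1 as
  well.\<close>

lemma gradient_step_to_1:
  assumes "y < 0" "0 < \<alpha>" "0 \<le> x" "\<bar>P\<bar> \<le> M" "ereal c \<le> D" "M + K \<le> - y * c" "1 \<le> \<alpha> * K"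
  shows "ereal P + ereal y * D \<le> ereal (- K)"
    and "proj01 (ereal x - ereal \<alpha> * (ereal P + ereal y * D)) = 1"
proof -
  show L: "ereal P + ereal y * D \<le> ereal (- K)"
  proof (cases D)
    case (real d)
    have "y * d \<le> y * c" using assms(1,5) real by (intro mult_left_mono_neg) auto
    then have "P + y * d \<le> - K" using assms(4,6) by (simp add: abs_le_iff)
    then show ?thesis using real by simp
  qed (use assms in auto)
  show "proj01 (ereal x - ereal \<alpha> * (ereal P + ereal y * D)) = 1"
  proof (cases "ereal P + ereal y * D")
    case (real l)
    then have "\<alpha> * l \<le> \<alpha> * (- K)" using L assms(2) by (intro mult_left_mono) auto
    then show ?thesis unfolding real using assms(3,7) by (intro proj01_eq_1) simp
  qed (use L assms in \<open>auto simp: proj01_simps\<close>)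
qed

lemma gradient_step_to_0:
  assumes "y < 0" "0 < \<alpha>" "x \<le> 1" "\<bar>P\<bar> \<le> M" "D \<le> ereal (- c)" "M + K \<le> - y * c" "1 \<le> \<alpha> * K"
  shows "ereal K \<le> ereal P + ereal y * D"
    and "proj01 (ereal x - ereal \<alpha> * (ereal P + ereal y * D)) = 0"
proof -
  show L: "ereal K \<le> ereal P + ereal y * D"
  proof (cases D)
    case (real d)
    have "y * (- c) \<le> y * d" using assms(1,5) real by (intro mult_left_mono_neg) auto
    then have "K \<le> P + y * d" using assms(4,6) by (simp add: abs_le_iff)
    then show ?thesis using real by simp
  qed (use assms in auto)
  show "proj01 (ereal x - ereal \<alpha> * (ereal P + ereal y * D)) = 0"
  proof (cases "ereal P + ereal y * D")
    case (real l)
    then have "\<alpha> * K \<le> \<alpha> * l" using L assms(2) by (intro mult_left_mono) auto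
    then show ?thesis unfolding real using assms(3,7) by (intro proj01_eq_0) simp
  qed (use L assms in \<open>auto simp: proj01_simps\<close>)
qed

section \<open>Behaviour of a single coordinate of the iterates\<close>

text \<open>A case distinction replaces induction, because both branches of the update land in [0,1]
  whatever the previous iterate was.\<close>

lemma pdbo_mem_cube:
  assumes "\<And>i. x0 $ i \<in> {0..1}" "0 < \<delta>" "\<delta> < 1/2"
  shows "fst (pdbo F g \<alpha> \<beta> \<delta> x0 y0 t) $ i \<in> {0..1}"
proof (cases t)
  case (Suc k)
  then show ?thesis
    using assms(2,3) proj01_mem by (simp add: pdbo_step_def split_beta)
qed (use assms(1) in simp)

lemma snd_pdbo_Suc:
  "snd (pdbo F g \<alpha> \<beta> \<delta> x0 y0 (Suc t)) $ i =
    snd (pdbo F g \<alpha> \<beta> \<delta> x0 y0 t) $ i + \<beta> * g (fst (pdbo F g \<alpha> \<beta> \<delta> x0 y0 t) $ i)"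
  by (simp add: pdbo_step_def split_beta)

lemma fst_pdbo_Suc:
  fixes F g \<alpha> \<beta> \<delta> x0 y0 i t
  defines "x \<equiv> fst (pdbo F g \<alpha> \<beta> \<delta> x0 y0 t)" and "y \<equiv> snd (pdbo F g \<alpha> \<beta> \<delta> x0 y0 t)"
  shows "fst (pdbo F g \<alpha> \<beta> \<delta> x0 y0 (Suc t)) $ i =
    (if \<bar>x $ i - 1/2\<bar> \<le> \<delta> \<and> \<bar>lagrangian_deriv F g i x y\<bar> \<le> ereal (2 * \<delta>) \<and> y $ i \<le> 0
     then (if x $ i \<le> 1/2 then 1/2 - \<delta> else 1/2 + \<delta>)
     else proj01 (ereal (x $ i) - ereal \<alpha> * lagrangian_deriv F g i x y))"
  by (simp add: pdbo_step_def split_beta x_def y_def)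

text \<open>The endpoints are at distance 1/2 from the centre, more than \<eta>, so the conclusion
  feeds its own hypothesis as long as the multiplier stays below \<open>B\<close>.\<close>

lemma pdbo_coordinate_trapped:
  fixes F g \<alpha> \<beta> \<delta> x0 y0 i
  defines "x \<equiv> \<lambda>t. fst (pdbo F g \<alpha> \<beta> \<delta> x0 y0 t) $ i"
    and "y \<equiv> \<lambda>t. snd (pdbo F g \<alpha> \<beta> \<delta> x0 y0 t) $ i"
  assumes g: "binarity_constraint g" and x0: "\<And>i. x0 $ i \<in> {0..1}"
    and pos: "0 < \<alpha>" "0 < \<delta>" and \<delta>: "\<delta> < 1/2" and \<eta>: "0 < \<eta>" "\<eta> < 1/2"
  obtains B where "\<And>t. y t \<le> B \<Longrightarrow> \<eta> \<le> \<bar>x t - 1/2\<bar> \<Longrightarrow> x (Suc t) \<in> {0, 1}"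
proof -
  obtain c where c: "0 < c"
    and right: "\<And>x. 1/2 + \<eta> \<le> x \<Longrightarrow> x \<le> 1 \<Longrightarrow> ereal c \<le> deriv01 g x"
    and left: "\<And>x. 0 \<le> x \<Longrightarrow> x \<le> 1/2 - \<eta> \<Longrightarrow> deriv01 g x \<le> ereal (- c)"
    using deriv01_away_from_half[OF g \<eta>] by blast
  define M where "M = (\<Sum>\<xi>\<in>UNIV. \<bar>F \<xi>\<bar>)"
  \<comment> \<open>The summand \<open>1 / \<alpha>\<close> makes the step at least as long as the
    interval; \<open>3 * \<delta>\<close> pushes the gradient beyond \<open>2 * \<delta>\<close>, so
    that the jump rule does not fire.\<close>
  define K where "K = 1 / \<alpha> + 3 * \<delta>"
  \<comment> \<open>At \<open>y = B\<close> the requirement \<open>M + K \<le> - y * c\<close> of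
    the gradient step lemmas is an equality, and smaller \<open>y\<close> preserve it.\<close>
  define B where "B = - (M + K) / c"
  have K: "1 \<le> \<alpha> * K" "2 * \<delta> < K" "0 < K"
    using pos by (auto simp: K_def algebra_simps add_pos_pos intro: add_pos_nonneg)
  have "0 \<le> M" by (simp add: M_def sum_nonneg)
  have B: "B < 0" using \<open>0 \<le> M\<close> K c by (simp add: B_def divide_neg_pos)
  have "x (Suc t) \<in> {0, 1}" if yB: "y t \<le> B" and away: "\<eta> \<le> \<bar>x t - 1/2\<bar>" for t
  proof -
    define X Y where "X = fst (pdbo F g \<alpha> \<beta> \<delta> x0 y0 t)" and "Y = snd (pdbo F g \<alpha> \<beta> \<delta> x0 y0 t)"
    define P where "P = partial_deriv (multilinear_ext F) i X"
    have cube: "X $ j \<in> {0..1}" for j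
      unfolding X_def using pdbo_mem_cube[OF x0 pos(2) \<delta>] .
    have P: "\<bar>P\<bar> \<le> M"
      unfolding P_def M_def by (rule abs_partial_deriv_multilinear_ext_le[OF cube])
    have L: "lagrangian_deriv F g i X Y = ereal P + ereal (y t) * deriv01 g (x t)"
      by (simp add: lagrangian_deriv_def P_def X_def Y_def x_def y_def)
    have yc: "M + K \<le> - y t * c"
      using yB c by (simp add: B_def field_simps)
    have y0: "y t < 0" using yB B by simp
    note Suc = fst_pdbo_Suc[of F g \<alpha> \<beta> \<delta> x0 y0 t i, folded X_def Y_def]
    have xt: "x t = X $ i" by (simp add: x_def X_def)
    consider "1/2 + \<eta> \<le> x t" | "x t \<le> 1/2 - \<eta>" using away by linarith
    then show ?thesis
    proof cases
      case 1
      have D: "ereal c \<le> deriv01 g (x t)" using right[OF 1] cube[of i] xt by simp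
      have x0': "0 \<le> x t" using cube[of i] xt by simp
      note to1 = gradient_step_to_1[OF y0 pos(1) x0' P D yc K(1), folded L]
      have "\<not> \<bar>lagrangian_deriv F g i X Y\<bar> \<le> ereal (2 * \<delta>)"
        using to1(1) K by (cases "lagrangian_deriv F g i X Y") auto
      then show ?thesis using Suc to1(2) by (simp add: x_def X_def)
    next
      case 2
      have D: "deriv01 g (x t) \<le> ereal (- c)" using left[OF _ 2] cube[of i] xt by simp
      have x1: "x t \<le> 1" using cube[of i] xt by simp
      note to0 = gradient_step_to_0[OF y0 pos(1) x1 P D yc K(1), folded L]
      have "\<not> \<bar>lagrangian_deriv F g i X Y\<bar> \<le> ereal (2 * \<delta>)"
        using to0(1) K by (cases "lagrangian_deriv F g i X Y") auto
      then show ?thesis using Suc to0(2) by (simp add: x_def X_def)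
    qed
  qed
  then show thesis by (rule that)
qed

text \<open>Each branch of the update uses one bound on \<eta>: a jump lands at distance \<delta>,
  which is at least \<eta>, and a gradient step with derivative above \<open>2 * \<delta>\<close> in
  absolute value is longer than \<open>2 * \<alpha> * \<delta>\<close>, hence than
  \<open>2 * \<eta>\<close>.\<close>

lemma pdbo_leaves_centre:
  fixes F g \<alpha> \<beta> \<delta> x0 y0 i
  defines "x \<equiv> \<lambda>t. fst (pdbo F g \<alpha> \<beta> \<delta> x0 y0 t) $ i"
    and "y \<equiv> \<lambda>t. snd (pdbo F g \<alpha> \<beta> \<delta> x0 y0 t) $ i"
  assumes "0 < \<alpha>" "\<delta> < 1/2" and \<eta>: "\<eta> \<le> \<delta>" "\<eta> \<le> \<alpha> * \<delta>"
    and "y t \<le> 0" and near: "\<bar>x t - 1/2\<bar> < \<eta>"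
  shows "\<eta> \<le> \<bar>x (Suc t) - 1/2\<bar>"
proof (rule ccontr)
  define X Y where "X = fst (pdbo F g \<alpha> \<beta> \<delta> x0 y0 t)" and "Y = snd (pdbo F g \<alpha> \<beta> \<delta> x0 y0 t)"
  define L where "L = lagrangian_deriv F g i X Y"
  note Suc = fst_pdbo_Suc[of F g \<alpha> \<beta> \<delta> x0 y0 t i, folded X_def Y_def, folded L_def]
  assume "\<not> \<eta> \<le> \<bar>x (Suc t) - 1/2\<bar>"
  then have near': "\<bar>x (Suc t) - 1/2\<bar> < \<eta>" by simp
  have xy: "x t = X $ i" "y t = Y $ i" by (simp_all add: x_def X_def y_def Y_def)
  have notspecial: "\<not> \<bar>L\<bar> \<le> ereal (2 * \<delta>)"
  proof
    assume "\<bar>L\<bar> \<le> ereal (2 * \<delta>)"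
    then have "x (Suc t) = (if x t \<le> 1/2 then 1/2 - \<delta> else 1/2 + \<delta>)"
      using Suc near \<eta>(1) \<open>y t \<le> 0\<close> xy unfolding x_def by simp
    then show False using near' \<eta>(1) by (auto split: if_splits)
  qed
  then have step: "x (Suc t) = proj01 (ereal (x t) - ereal \<alpha> * L)"
    using Suc unfolding xy by (simp add: x_def)
  have "0 < x (Suc t)" "x (Suc t) < 1"
    using near' \<eta>(1) \<open>\<delta> < 1/2\<close> by linarith+
  \<comment> \<open>The new iterate is interior, so nothing was clipped; in particular the gradient
    is finite and can be read off from the displacement.\<close>
  then have eq: "ereal (x t) - ereal \<alpha> * L = ereal (x (Suc t))"
    unfolding step by (rule proj01_interior)
  show False
  proof (cases L)
    case (real l)
    then have "\<alpha> * \<bar>l\<bar> = \<bar>x t - x (Suc t)\<bar>"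
      using eq \<open>0 < \<alpha>\<close> by (simp flip: abs_mult_pos' add: algebra_simps)
    also have "\<dots> \<le> 2 * \<eta>" using near near' by linarith
    also have "\<dots> \<le> \<alpha> * (2 * \<delta>)" using \<eta>(2) by simp
    finally show False using \<open>0 < \<alpha>\<close> notspecial real by simp
  qed (use eq \<open>0 < \<alpha>\<close> in auto)
qed

section \<open>Convergence by cases on the boundedness of the multiplier\<close>

theorem corollary3p5:
  fixes F :: "bool ^ 'n::finite \<Rightarrow> real"
    and g :: "real \<Rightarrow> real"
    and x0 y0 :: "real ^ 'n"
    and \<alpha> \<beta> \<delta> :: real
  assumes "binarity_constraint g"
    and "\<And>i. x0 $ i \<in> {0..1}"
    and "\<And>i. y0 $ i > 0"
    and "\<alpha> > 0" and "\<beta> > 0"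
    and "0 < \<delta>" and "\<delta> < 1/2"
  shows "\<forall>i. (\<lambda>t. g (fst (pdbo F g \<alpha> \<beta> \<delta> x0 y0 t) $ i)) \<longlonglongrightarrow> 0"
proof
  fix i
  define x y where "x t = fst (pdbo F g \<alpha> \<beta> \<delta> x0 y0 t) $ i"
    and "y t = snd (pdbo F g \<alpha> \<beta> \<delta> x0 y0 t) $ i" for t
  have y_Suc: "y (Suc t) = y t + \<beta> * g (x t)" for t
    unfolding x_def y_def by (rule snd_pdbo_Suc)
  have "g (x t) \<le> 0" for t
    unfolding x_def
    by (intro binarity_constraint_nonpos pdbo_mem_cube assms)
  then have dec: "decseq y"
    using \<open>\<beta> > 0\<close> by (intro decseq_SucI) (simp add: y_Suc mult_nonneg_nonpos)
  have "(\<lambda>t. g (x t)) \<longlonglongrightarrow> 0"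
  proof (cases "\<exists>b. \<forall>t. b \<le> y t")
    case True
    then obtain l where l: "y \<longlonglongrightarrow> l"
      using decseq_convergent[OF dec] by metis
    \<comment> \<open>The quotient is exactly \<open>g (x t)\<close>, by the multiplier
      update.\<close>
    have "(\<lambda>t. (y (Suc t) - y t) / \<beta>) \<longlonglongrightarrow> (l - l) / \<beta>"
      using l \<open>\<beta> > 0\<close> by (intro tendsto_intros LIMSEQ_Suc) auto
    then show ?thesis using \<open>\<beta> > 0\<close> by (simp add: y_Suc)
  next
    case False
    define \<eta> where "\<eta> = min \<delta> (\<alpha> * \<delta>)"
    have \<eta>: "0 < \<eta>" "\<eta> < 1/2" "\<eta> \<le> \<delta>" "\<eta> \<le> \<alpha> * \<delta>"
      using assms(4-) by (auto simp: \<eta>_def)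
    obtain B where trap: "\<And>t. y t \<le> B \<Longrightarrow> \<eta> \<le> \<bar>x t - 1/2\<bar> \<Longrightarrow> x (Suc t) \<in> {0, 1}"
      using pdbo_coordinate_trapped[OF assms(1,2,4,6,7) \<eta>(1,2), of F \<beta> y0 i]
      unfolding x_def y_def by blast
    \<comment> \<open>Below \<open>B\<close> the trapping step applies; below 0 the sign condition
      of the jump rule holds. Both persist because \<open>y\<close> is nonincreasing.\<close>
    obtain T where T: "y T < min B 0"
      using False by (meson not_le)
    have yB: "y t \<le> B" "y t \<le> 0" if "T \<le> t" for t
      using decseqD[OF dec that] T by auto
    \<comment> \<open>Either \<open>T\<close> or \<open>T + 1\<close> works, since the centre is
      left after at most one step.\<close>
    obtain S where S: "T \<le> S" "\<eta> \<le> \<bar>x S - 1/2\<bar>"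
    proof (cases "\<eta> \<le> \<bar>x T - 1/2\<bar>")
      case False
      then have "\<eta> \<le> \<bar>x (Suc T) - 1/2\<bar>"
        using pdbo_leaves_centre[OF assms(4,7) \<eta>(3,4), of F g \<beta> x0 y0 T i] yB(2)[of T]
        unfolding x_def y_def by auto
      then show thesis by (rule that[of "Suc T", OF le_SucI[OF order_refl]])
    qed (use that in blast)
    \<comment> \<open>At \<open>S\<close> the iterate is only known to be away from 1/2, so the
      first endpoint value is reached at \<open>S + 1\<close>; from then on the trap sustains
      itself.\<close>
    have "x (Suc t) \<in> {0, 1}" if "S \<le> t" for t
      using that
    proof (induction t rule: dec_induct)
      case base
      show ?case using trap yB S by blast
    next
      case (step t)
      then have "\<eta> \<le> \<bar>x (Suc t) - 1/2\<bar>" using \<eta>(2) by auto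
      then show ?case using trap yB S(1) step(1) by simp
    qed
    then have "eventually (\<lambda>t. g (x (Suc t)) = 0) sequentially"
      unfolding eventually_sequentially using binarity_constraintD(2,3)[OF assms(1)]
      by (metis empty_iff insert_iff)
    then have "(\<lambda>t. g (x (Suc t))) \<longlonglongrightarrow> 0"
      by (rule tendsto_eventually)
    then show ?thesis by (rule LIMSEQ_imp_Suc)
  qed
  then show "(\<lambda>t. g (fst (pdbo F g \<alpha> \<beta> \<delta> x0 y0 t) $ i)) \<longlonglongrightarrow> 0"
    by (simp add: x_def)
qed

end
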